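(* Let $u$ be a smooth function in the stencil $\{\Omega_{j-1},\Omega_j,\Omega_{j+1}\}$ of three adjacent cells with sizes $h_{j-1}=\beta h$, $h_j=h$, $h_{j+1}=\gamma h$. Let $u^-_{j+1/2}$ and $u^+_{j-1/2}$ be the WENO3 reconstructed values at the right and left boundary of $\Omega_j$ (defined in the context), computed with $\epsilon=\hat\epsilon h$ or with $\epsilon=\hat\epsilon h^2$. Then $$u(x_{j+1/2})=u^-_{j+1/2}+\mathcal{O}(h^3),\qquad u(x_{j-1/2})=u^+_{j-1/2}+\mathcal{O}(h^3).$$
   Context: Cells: $\Omega_j=[x_j-\tfrac h2,x_j+\tfrac h2]$, $\Omega_{j-1}=[x_j-\tfrac h2-\beta h,\,x_j-\tfrac h2]$, $\Omega_{j+1}=[x_j+\tfrac h2,\,x_j+\tfrac h2+\gamma h]$; $x_{j\pm1/2}=x_j\pm\tfrac h2$. Cell averages: $\bar u_i=\frac1{|\Omega_i|}\int_{\Omega_i}u(x)\,dx$, $i=j-1,j,j+1$. The point $x_j$, the size ratios $\beta,\gamma>0$, the constant $\hat\epsilon>0$, the exponent $\tau$ and the function $u$ are fixed, and all $\mathcal{O}(\cdot)$ are as $h\to0^+$. Candidate polynomials: $P_{j,L}(x)=\bar u_j+\sigma_{j,-}(x-x_j)$, $P_{j,R}(x)=\bar u_j+\sigma_{j,+}(x-x_j)$ with $\sigma_{j,-}=2\frac{\bar u_j-\bar u_{j-1}}{(1+\beta)h}$, $\sigma_{j,+}=2\frac{\bar u_{j+1}-\bar u_j}{(1+\gamma)h}$.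 Linear weights (the superscript $+$ refers to reconstruction at $x_{j+1/2}$, the superscript $-$ to reconstruction at $x_{j-1/2}$): $$C^+_{j,L}=\frac{\gamma}{1+\beta+\gamma},\quad C^+_{j,R}=\frac{1+\beta}{1+\beta+\gamma},\quad C^-_{j,L}=\frac{1+\beta}{1+\beta+\gamma},\quad C^-_{j,R}=\frac{\gamma}{1+\beta+\gamma}.$$ Smoothness indicators: $I_{j,\lambda}=\sum_{r\ge1}h^{2r-1}\int_{\Omega_j}[P_{j,\lambda}^{(r)}(x)]^2dx$ for $\lambda\in\{L,R\}$, i.e. $I_{j,L}=h^2\sigma_{j,-}^2$, $I_{j,R}=h^2\sigma_{j,+}^2$. Nonlinear weights: $\widetilde\omega^\pm_{j,\lambda}=\dfrac{C^\pm_{j,\lambda}}{(\epsilon+I_{j,\lambda})^\tau}$, $\quad\omega^\pm_{j,\lambda}=\dfrac{\widetilde\omega^\pm_{j,\lambda}}{\widetilde\omega^\pm_{j,L}+\widetilde\omega^\pm_{j,R}}$, $\lambda\in\{L,R\}$. WENO3 reconstructed values: $$u^+_{j-1/2}=\omega^-_{j,L}P_{j,L}(x_{j-1/2})+\omega^-_{j,R}P_{j,R}(x_{j-1/2}),\qquad u^-_{j+1/2}=\omega^+_{j,L}P_{j,L}(x_{j+1/2})+\omega^+_{j,R}P_{j,R}(x_{j+1/2}).$$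
   Formalization: The linear weights at x_{j-1/2} are corrected to C^-_{j,L}=(1+γ)/(1+β+γ), C^-_{j,R}=β/(1+β+γ); with the printed ones (1+β and γ as numerators) the second estimate fails for β≠γ, e.g. u=x² at x_j=0 has error of order h². *)

theory Defs
  imports "HOL-Analysis.Analysis" "HOL-Computational_Algebra.Polynomial" "HOL-Library.Landau_Symbols"
begin

text \<open>Derivatives of all orders, taken within \<open>S\<close>, hence one-sided at the end points when \<open>S\<close> is a
  closed interval.\<close>

definition smooth_on :: "real set \<Rightarrow> (real \<Rightarrow> real) \<Rightarrow> bool" where
  "smooth_on S f \<longleftrightarrow>
     (\<exists>D :: nat \<Rightarrow> real \<Rightarrow> real.
        (\<forall>x\<in>S. D 0 x = f x) \<and>
        (\<forall>n. \<forall>x\<in>S. (D n has_real_derivative D (Suc n) x) (at x within S)))"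

definition cell_left :: "real \<Rightarrow> real \<Rightarrow> real \<Rightarrow> real set" where
  "cell_left xj \<beta> h = {xj - h / 2 - \<beta> * h .. xj - h / 2}"

definition cell_mid :: "real \<Rightarrow> real \<Rightarrow> real set" where
  "cell_mid xj h = {xj - h / 2 .. xj + h / 2}"

definition cell_right :: "real \<Rightarrow> real \<Rightarrow> real \<Rightarrow> real set" where
  "cell_right xj \<gamma> h = {xj + h / 2 .. xj + h / 2 + \<gamma> * h}"

definition stencil :: "real \<Rightarrow> real \<Rightarrow> real \<Rightarrow> real \<Rightarrow> real set" where
  "stencil xj \<beta> \<gamma> h = cell_left xj \<beta> h \<union> cell_mid xj h \<union> cell_right xj \<gamma> h"

definition cell_avg :: "(real \<Rightarrow> real) \<Rightarrow> real set \<Rightarrow> real" where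
  "cell_avg u S = (1 / measure lborel S) * integral S u"

datatype side = SideL | SideR

fun slope :: "(real \<Rightarrow> real) \<Rightarrow> real \<Rightarrow> real \<Rightarrow> real \<Rightarrow> real \<Rightarrow> side \<Rightarrow> real" where
  "slope u xj \<beta> \<gamma> h SideL =
     2 * (cell_avg u (cell_mid xj h) - cell_avg u (cell_left xj \<beta> h)) / ((1 + \<beta>) * h)"
| "slope u xj \<beta> \<gamma> h SideR =
     2 * (cell_avg u (cell_right xj \<gamma> h) - cell_avg u (cell_mid xj h)) / ((1 + \<gamma>) * h)"

definition cand_poly :: "(real \<Rightarrow> real) \<Rightarrow> real \<Rightarrow> real \<Rightarrow> real \<Rightarrow> real \<Rightarrow> side \<Rightarrow> real poly" where
  "cand_poly u xj \<beta> \<gamma> h s =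
     [:cell_avg u (cell_mid xj h):] + smult (slope u xj \<beta> \<gamma> h s) [:- xj, 1:]"

text \<open>\<open>Plus\<close> and \<open>Minus\<close> are the superscripts of the weights: \<open>Plus\<close> is reconstruction at
  \<open>xj + h / 2\<close>, \<open>Minus\<close> at \<open>xj - h / 2\<close>. The reconstructed values themselves carry the opposite
  superscript (the side from which the cell interface is approached).\<close>

datatype bdry = Plus | Minus

fun bdry_point :: "real \<Rightarrow> real \<Rightarrow> bdry \<Rightarrow> real" where
  "bdry_point xj h Plus = xj + h / 2"
| "bdry_point xj h Minus = xj - h / 2"

text \<open>The linear weights make the convex combination of the two candidates agree, at the boundary
  point in question, with the parabola having the three given cell averages. Reflecting the cell
  about \<open>xj\<close> exchanges \<open>Plus\<close> with \<open>Minus\<close>, \<open>SideL\<close> with \<open>SideR\<close> and also \<open>\<beta>\<close> with \<open>\<gamma>\<close>. The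
  source prints the numerators \<open>1 + \<beta>\<close> and \<open>\<gamma>\<close> for \<open>Minus\<close>, omitting the last exchange; this
  coincides with the weights below when \<open>\<beta> = \<gamma>\<close>, but for \<open>\<beta> \<noteq> \<gamma>\<close> gives only second order
  (already for \<open>u x = x\<^sup>2 + x\<close>).\<close>

fun lin_weight :: "real \<Rightarrow> real \<Rightarrow> bdry \<Rightarrow> side \<Rightarrow> real" where
  "lin_weight \<beta> \<gamma> Plus SideL = \<gamma> / (1 + \<beta> + \<gamma>)"
| "lin_weight \<beta> \<gamma> Plus SideR = (1 + \<beta>) / (1 + \<beta> + \<gamma>)"
| "lin_weight \<beta> \<gamma> Minus SideL = (1 + \<gamma>) / (1 + \<beta> + \<gamma>)"
| "lin_weight \<beta> \<gamma> Minus SideR = \<beta> / (1 + \<beta> + \<gamma>)"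

text \<open>The derivative order is \<open>Suc r\<close>, so that the power of \<open>h\<close> is \<open>2 * Suc r - 1\<close>.\<close>

definition smooth_ind :: "(real \<Rightarrow> real) \<Rightarrow> real \<Rightarrow> real \<Rightarrow> real \<Rightarrow> real \<Rightarrow> side \<Rightarrow> real" where
  "smooth_ind u xj \<beta> \<gamma> h s =
     (\<Sum>r. h ^ (2 * Suc r - 1) *
        integral (cell_mid xj h) (\<lambda>x. (poly ((pderiv ^^ Suc r) (cand_poly u xj \<beta> \<gamma> h s)) x)\<^sup>2))"

lemma smooth_ind_eq:
  assumes "0 \<le> h"
  shows "smooth_ind u xj \<beta> \<gamma> h s = h\<^sup>2 * (slope u xj \<beta> \<gamma> h s)\<^sup>2"
proof -
  let ?P = "cand_poly u xj \<beta> \<gamma> h s" and ?\<sigma> = "slope u xj \<beta> \<gamma> h s"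
  have d1: "pderiv ?P = [:?\<sigma>:]"
    by (simp add: cand_poly_def pderiv_add pderiv_smult pderiv_pCons)
  have dk: "(pderiv ^^ Suc k) [:?\<sigma>:] = 0" for k
    by (induction k) (simp_all add: pderiv_pCons)
  have ds: "(pderiv ^^ Suc r) ?P = (if r = 0 then [:?\<sigma>:] else 0)" for r
    using dk d1 by (cases r) (simp_all only: funpow_Suc_right o_apply, simp_all)
  have "smooth_ind u xj \<beta> \<gamma> h s = (\<Sum>r. if r = 0 then h\<^sup>2 * ?\<sigma>\<^sup>2 else 0)"
    unfolding smooth_ind_def ds
    by (rule arg_cong[where f = suminf])
       (use assms in \<open>auto simp: fun_eq_iff cell_mid_def power2_eq_square\<close>)
  then show ?thesis
    using suminf_finite[of "{0}" "\<lambda>r. if r = 0 then h\<^sup>2 * ?\<sigma>\<^sup>2 else 0"] by simp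
qed

definition weight_tilde ::
  "(real \<Rightarrow> real) \<Rightarrow> real \<Rightarrow> real \<Rightarrow> real \<Rightarrow> real \<Rightarrow> real \<Rightarrow> real \<Rightarrow> bdry \<Rightarrow> side \<Rightarrow> real" where
  "weight_tilde u xj \<beta> \<gamma> \<tau> \<epsilon> h b s =
     lin_weight \<beta> \<gamma> b s / (\<epsilon> + smooth_ind u xj \<beta> \<gamma> h s) powr \<tau>"

definition weight ::
  "(real \<Rightarrow> real) \<Rightarrow> real \<Rightarrow> real \<Rightarrow> real \<Rightarrow> real \<Rightarrow> real \<Rightarrow> real \<Rightarrow> bdry \<Rightarrow> side \<Rightarrow> real" where
  "weight u xj \<beta> \<gamma> \<tau> \<epsilon> h b s =
     weight_tilde u xj \<beta> \<gamma> \<tau> \<epsilon> h b s /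
       (weight_tilde u xj \<beta> \<gamma> \<tau> \<epsilon> h b SideL + weight_tilde u xj \<beta> \<gamma> \<tau> \<epsilon> h b SideR)"

definition weno3 ::
  "(real \<Rightarrow> real) \<Rightarrow> real \<Rightarrow> real \<Rightarrow> real \<Rightarrow> real \<Rightarrow> real \<Rightarrow> real \<Rightarrow> bdry \<Rightarrow> real" where
  "weno3 u xj \<beta> \<gamma> \<tau> \<epsilon> h b =
     weight u xj \<beta> \<gamma> \<tau> \<epsilon> h b SideL * poly (cand_poly u xj \<beta> \<gamma> h SideL) (bdry_point xj h b) +
     weight u xj \<beta> \<gamma> \<tau> \<epsilon> h b SideR * poly (cand_poly u xj \<beta> \<gamma> h SideR) (bdry_point xj h b)"

end

(* With the linear weights the combination of the two candidates is the value of the parabola with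
   the three given cell averages, which is third-order accurate. Replacing them by the nonlinear
   weights changes the result by  h/2 * (w_L - C_L) * (sigma_L - sigma_R)  up to sign. The slopes
   differ by O(h), and so I_L - I_R = h^2 * O(h) = O(h^3), while  eps + I  is at least a multiple of
   h^2. Hence  (eps + I_L) / (eps + I_R) = 1 + O(h),  and the weights deviate by O(h) only. *)
theory Submission
  imports Defs
begin

section \<open>Local Taylor expansion and averages over an interval\<close>

text \<open>Taylor's theorem with Lagrange remainder; the third derivative is bounded on a compact
  neighbourhood of \<open>x\<close>. Coefficients, radius and \<open>M\<close> do not depend on
  \<open>t\<close>, so one expansion later serves all mesh sizes.\<close>

lemma taylor_quadratic_remainder:
  fixes f :: "real \<Rightarrow> real"
  assumes "smooth_on {a..b} f" "a < x" "x < b"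
  obtains \<delta> p0 p1 p2 M where "\<delta> > 0" "continuous_on {x - \<delta>..x + \<delta>} f"
    "\<And>t. \<bar>t\<bar> \<le> \<delta> \<Longrightarrow> \<bar>f (x + t) - (p0 + p1 * t + p2 * t\<^sup>2)\<bar> \<le> M * \<bar>t\<bar> ^ 3"
proof -
  obtain D where D0: "\<forall>y\<in>{a..b}. D 0 y = f y"
    and D: "\<forall>n. \<forall>y\<in>{a..b}. (D n has_real_derivative D (Suc n) y) (at y within {a..b})"
    using assms(1) unfolding smooth_on_def by blast
  \<comment> \<open>Half the distance to the nearer end point keeps the closed interval of radius
    \<open>\<delta>\<close> inside the open one, where the one-sided derivatives of
    \<open>smooth_on\<close> are ordinary ones.\<close>
  define \<delta> where "\<delta> = min (x - a) (b - x) / 2"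
  have \<delta>: "\<delta> > 0" and sub: "{x - \<delta>..x + \<delta>} \<subseteq> {a<..<b}"
  proof -
    have "\<delta> < x - a" "\<delta> < b - x" using assms by (simp_all add: \<delta>_def min_def field_simps)
    then show "{x - \<delta>..x + \<delta>} \<subseteq> {a<..<b}" by auto
  qed (use assms in \<open>simp add: \<delta>_def\<close>)
  have der: "(D n has_real_derivative D (Suc n) y) (at y)" if "y \<in> {x - \<delta>..x + \<delta>}" for n y
  proof -
    have "a < y" "y < b" using sub that by auto
    then show ?thesis using D[rule_format, of y n] by (simp add: at_within_Icc_at)
  qed
  have cont: "continuous_on {x - \<delta>..x + \<delta>} (D n)" for n
    using der by (meson DERIV_isCont continuous_at_imp_continuous_on)
  have "continuous_on {x - \<delta>..x + \<delta>} f"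
    using cont[of 0] by (rule continuous_on_eq) (use D0 sub in auto)
  moreover obtain M where M: "\<And>y. y \<in> {x - \<delta>..x + \<delta>} \<Longrightarrow> \<bar>D 3 y\<bar> \<le> M"
  proof -
    have "bounded (D 3 ` {x - \<delta>..x + \<delta>})"
      by (intro compact_imp_bounded compact_continuous_image cont compact_Icc)
    then obtain M where "\<forall>y\<in>D 3 ` {x - \<delta>..x + \<delta>}. norm y \<le> M"
      unfolding bounded_iff by blast
    then have "\<bar>D 3 y\<bar> \<le> M" if "y \<in> {x - \<delta>..x + \<delta>}" for y
      using that by auto
    then show thesis using that by blast
  qed
  have "\<bar>f (x + t) - (D 0 x + D 1 x * t + D 2 x / 2 * t\<^sup>2)\<bar> \<le> (M / 6) * \<bar>t\<bar> ^ 3" if t: "\<bar>t\<bar> \<le> \<delta>" for t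
  \<comment> \<open>The rule \<open>Taylor\<close> requires two distinct points; at
    \<open>t = 0\<close> both sides vanish.\<close>
  proof (cases "t = 0")
    case True
    then show ?thesis using D0 assms by simp
  next
    case False
    have "\<exists>s. (if x + t < x then x + t < s \<and> s < x else x < s \<and> s < x + t) \<and>
       D 0 (x + t) = (\<Sum>m<3. D m x / fact m * (x + t - x) ^ m) + D 3 s / fact 3 * (x + t - x) ^ 3"
      by (rule Taylor[where a = "x - \<delta>" and b = "x + \<delta>"]) (use t False \<delta> der in auto)
    then obtain s where between: "if x + t < x then x + t < s \<and> s < x else x < s \<and> s < x + t"
      and e: "D 0 (x + t) = (\<Sum>m<3. D m x / fact m * t ^ m) + D 3 s / fact 3 * t ^ 3"
      by auto
    have s: "s \<in> {x - \<delta>..x + \<delta>}" using between t by (auto split: if_splits)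
    have "x + t \<in> {x - \<delta>..x + \<delta>}" using t by auto
    then have "D 0 (x + t) = f (x + t)" using D0 sub by fastforce
    moreover have "(\<Sum>m<3. D m x / fact m * t ^ m) = D 0 x + D 1 x * t + D 2 x / 2 * t\<^sup>2"
      by (simp add: eval_nat_numeral)
    ultimately have "f (x + t) - (D 0 x + D 1 x * t + D 2 x / 2 * t\<^sup>2) = D 3 s / 6 * t ^ 3"
      using e by (simp add: fact_numeral)
    then have "\<bar>f (x + t) - (D 0 x + D 1 x * t + D 2 x / 2 * t\<^sup>2)\<bar> = \<bar>D 3 s\<bar> / 6 * \<bar>t\<bar> ^ 3"
      by (simp only: abs_mult power_abs abs_divide abs_numeral)
    then show ?thesis
      using mult_right_mono[OF M[OF s], of "\<bar>t\<bar> ^ 3"] by simp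
  qed
  ultimately show thesis using that \<delta> by blast
qed

text \<open>The subtracted expression is the exact mean of the quadratic over the interval, and
  averaging preserves a uniform error bound.\<close>

lemma cell_avg_near_quadratic:
  fixes u :: "real \<Rightarrow> real"
  assumes "a < b" "continuous_on {x + a..x + b} u"
    and "\<And>t. a \<le> t \<Longrightarrow> t \<le> b \<Longrightarrow> \<bar>u (x + t) - (p0 + p1 * t + p2 * t\<^sup>2)\<bar> \<le> B"
  shows "\<bar>cell_avg u {x + a..x + b} - (p0 + p1 * (a + b) / 2 + p2 * (a\<^sup>2 + a * b + b\<^sup>2) / 3)\<bar> \<le> B"
proof -
  let ?q = "\<lambda>y. p0 + p1 * (y - x) + p2 * (y - x)\<^sup>2"
  let ?Q = "\<lambda>y. p0 * (y - x) + p1 * (y - x)\<^sup>2 / 2 + p2 * (y - x) ^ 3 / 3"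
  let ?m = "p0 + p1 * (a + b) / 2 + p2 * (a\<^sup>2 + a * b + b\<^sup>2) / 3"
  have "(?q has_integral ?Q (x + b) - ?Q (x + a)) {x + a..x + b}"
    using assms(1)
    by (intro fundamental_theorem_of_calculus)
       (auto intro!: derivative_eq_intros
         simp: has_real_derivative_iff_has_vector_derivative[symmetric] power2_eq_square)
  moreover have "?Q (x + b) - ?Q (x + a) = (b - a) * ?m"
    by (simp add: field_simps power2_eq_square power3_eq_cube)
  ultimately have q: "(?q has_integral (b - a) * ?m) {x + a..x + b}" by simp
  have u: "(u has_integral integral {x + a..x + b} u) {x + a..x + b}"
    using assms(2) by (intro integrable_integral integrable_continuous_interval)
  have "norm (integral {x + a..x + b} u - (b - a) * ?m) \<le> B * measure lborel {x + a..x + b}"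
  proof (rule has_integral_bound_real[OF _ finite.emptyI has_integral_diff[OF u q]])
    show "0 \<le> B" using assms(3)[of a] assms(1) by linarith
    show "norm (u y - ?q y) \<le> B" if "y \<in> {x + a..x + b} - {}" for y
      using assms(3)[of "y - x"] that by simp
  qed
  then have "\<bar>integral {x + a..x + b} u - (b - a) * ?m\<bar> / (b - a) \<le> B"
    using assms(1) by (simp add: field_simps)
  moreover have "cell_avg u {x + a..x + b} - ?m = (integral {x + a..x + b} u - (b - a) * ?m) / (b - a)"
    using assms(1) by (simp add: cell_avg_def diff_divide_distrib)
  ultimately show ?thesis using assms(1) by (simp add: abs_divide)
qed

section \<open>Auxiliary facts on growth rates and normalized weights\<close>

text \<open>The map \<open>x powr \<tau>\<close> is differentiable at 1, so its difference quotient
  is bounded there; the two hypotheses force \<open>g\<close> to tend to 1.\<close>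

lemma powr_minus_one_bigo:
  fixes g :: "'a \<Rightarrow> real"
  assumes "(\<lambda>h. g h - 1) \<in> O[F](f)" "(f \<longlongrightarrow> 0) F"
  shows "(\<lambda>h. g h powr \<tau> - 1) \<in> O[F](f)"
proof -
  have "((\<lambda>x. x powr \<tau>) has_real_derivative \<tau>) (at 1)"
    by (auto intro!: derivative_eq_intros)
  then have "((\<lambda>x. (x powr \<tau> - 1) / (x - 1)) \<longlongrightarrow> \<tau>) (at 1)"
    by (simp add: has_field_derivative_iff)
  then have "(\<lambda>x. x powr \<tau> - 1) \<in> O[at 1](\<lambda>x. x - 1)"
    by (rule bigoI_tendsto) (auto simp: eventually_at_filter)
  then obtain c where "\<forall>\<^sub>F x in at 1. norm (x powr \<tau> - 1) \<le> c * norm (x - 1)"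
    by (elim landau_o.bigE)
  \<comment> \<open>The estimate extends to the point 1 itself, where both sides are 0; this matters
    because \<open>g\<close> may take the value 1.\<close>
  then have ev: "\<forall>\<^sub>F x in nhds 1. norm (x powr \<tau> - 1) \<le> c * norm (x - 1)"
    unfolding eventually_at_filter by eventually_elim auto
  have "((\<lambda>h. g h - 1) \<longlongrightarrow> 0) F"
  proof -
    obtain k where "\<forall>\<^sub>F h in F. norm (g h - 1) \<le> k * norm (f h)"
      using assms(1) by (elim landau_o.bigE)
    moreover have "((\<lambda>h. k * norm (f h)) \<longlongrightarrow> 0) F"
      using tendsto_mult_right_zero[OF tendsto_norm_zero[OF assms(2)]] .
    ultimately show ?thesis by (rule Lim_null_comparison)
  qed
  then have "(g \<longlongrightarrow> 1) F" by (simp add: LIM_zero_iff)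
  then have "\<forall>\<^sub>F h in F. norm (g h powr \<tau> - 1) \<le> c * norm (g h - 1)"
    using ev filterlim_iff by blast
  then have "(\<lambda>h. g h powr \<tau> - 1) \<in> O[F](\<lambda>h. g h - 1)" by (rule bigoI)
  then show ?thesis using assms(1) landau_o.big_trans by blast
qed

lemma power_bigo_at_right_0:
  assumes "m \<le> n"
  shows "(\<lambda>h::real. h ^ n) \<in> O[at_right 0](\<lambda>h. h ^ m)"
proof (rule bigoI[where c = 1])
  have "\<forall>\<^sub>F h in at_right (0::real). 0 < h \<and> h < 1"
    unfolding eventually_at_right_field by (intro exI[of _ 1]) auto
  then show "\<forall>\<^sub>F h in at_right (0::real). norm (h ^ n) \<le> 1 * norm (h ^ m)"
    by eventually_elim (use assms in \<open>auto intro: power_decreasing\<close>)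
qed

text \<open>Turns the error of a difference of averages into the error of a slope: \<open>k\<close>
  is \<open>1 + \<beta>\<close> or \<open>1 + \<gamma>\<close>, \<open>y\<close> the difference of
  the averages, \<open>z\<close> the predicted slope.\<close>

lemma scaled_difference_eq:
  fixes h k x y z :: real
  assumes "k > 0" "h > 0" "x = y - k * h / 2 * z"
  shows "2 / k * (x * inverse h) = 2 * y / (k * h) - z"
  using assms by (simp add: field_simps)

text \<open>With \<open>r = a / b\<close> the normalized weight is \<open>c / (c + d * r)\<close>,
  and its deviation from \<open>c\<close> is this weight times \<open>d * (1 - r)\<close>. Both the
  weight and \<open>d\<close> are at most 1.\<close>

lemma normalized_weight_diff:
  fixes a b c d :: real
  assumes "a > 0" "b > 0" "c > 0" "d > 0" "c + d = 1"
  shows "\<bar>c / a / (c / a + d / b) - c\<bar> \<le> \<bar>a / b - 1\<bar>"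
proof -
  define r where "r = a / b"
  have r: "r > 0" "a = b * r" using assms by (auto simp: r_def)
  have pos: "c + d * r > 0" using assms r by (simp add: add_pos_pos)
  have quot: "c / a / (c / a + d / b) = c / (c + d * r)"
    using assms(2-4) r pos by (simp add: divide_simps)
  have d: "d = 1 - c" using assms by simp
  have diff: "c / (c + d * r) - c = c / (c + d * r) * (d * (1 - r))"
    using pos unfolding d by (simp add: field_simps)
  have "\<bar>c / a / (c / a + d / b) - c\<bar> = c / (c + d * r) * (d * \<bar>1 - r\<bar>)"
    unfolding quot diff using assms pos by (simp add: abs_mult)
  also have "\<dots> \<le> 1 * (1 * \<bar>1 - r\<bar>)"
    using assms r pos by (intro mult_mono) auto
  finally show ?thesis by (simp add: r_def abs_minus_commute)
qed

section \<open>Algebra of the linear weights\<close>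

lemma lin_weight_pos: "\<beta> > 0 \<Longrightarrow> \<gamma> > 0 \<Longrightarrow> lin_weight \<beta> \<gamma> b s > 0"
  by (cases b; cases s) auto

lemma lin_weight_sum: "\<beta> > 0 \<Longrightarrow> \<gamma> > 0 \<Longrightarrow> lin_weight \<beta> \<gamma> b SideL + lin_weight \<beta> \<gamma> b SideR = 1"
  by (cases b) (auto simp: add_divide_distrib[symmetric])

text \<open>Position of the boundary point relative to \<open>xj\<close> in units of
  \<open>h\<close>, so that both boundaries share one argument.\<close>

definition bdry_offset :: "bdry \<Rightarrow> real" where
  "bdry_offset b = (case b of Plus \<Rightarrow> 1 / 2 | Minus \<Rightarrow> - 1 / 2)"

lemma bdry_point_eq: "bdry_point xj h b = xj + bdry_offset b * h"
  by (cases b) (auto simp: bdry_offset_def)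

lemma bdry_offset_sq: "(bdry_offset b)\<^sup>2 = 1 / 4"
  by (cases b) (auto simp: bdry_offset_def power2_eq_square)

text \<open>This is the condition for third order. The slopes deviate from \<open>p1\<close> by
  \<open>- p2 * (1 + 2 * \<beta>) / 3 * h\<close> and \<open>p2 * (1 + 2 * \<gamma>) / 3 * h\<close>
  to leading order; weighted, these must combine to the slope correction of the parabola at the
  boundary.\<close>

lemma lin_weight_moment:
  assumes "\<beta> > 0" "\<gamma> > 0"
  shows "lin_weight \<beta> \<gamma> b SideR * (1 + 2 * \<gamma>) - lin_weight \<beta> \<gamma> b SideL * (1 + 2 * \<beta>) =
    2 * bdry_offset b"
proof -
  have "1 + \<beta> + \<gamma> \<noteq> 0" using assms by linarith
  then show ?thesis
    by (cases b) (simp_all add: bdry_offset_def divide_simps, simp_all add: algebra_simps)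
qed

section \<open>Expansions of point values, averages and slopes in \<open>h\<close>\<close>

context
  fixes u :: "real \<Rightarrow> real" and xj \<delta> p0 p1 p2 M :: real
  assumes \<delta>: "\<delta> > 0" and cont: "continuous_on {xj - \<delta>..xj + \<delta>} u"
    and quad: "\<And>t. \<bar>t\<bar> \<le> \<delta> \<Longrightarrow> \<bar>u (xj + t) - (p0 + p1 * t + p2 * t\<^sup>2)\<bar> \<le> M * \<bar>t\<bar> ^ 3"
begin

text \<open>Keeps points within \<open>K\<close> mesh widths of \<open>xj\<close> in the range of
  the expansion.\<close>

lemma eventually_scaled_le: "\<forall>\<^sub>F h in at_right 0. h > 0 \<and> K * h \<le> \<delta>"
proof -
  have "((\<lambda>h. K * h) \<longlongrightarrow> K * 0) (at_right (0::real))" by (intro tendsto_intros)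
  then have "\<forall>\<^sub>F h in at_right 0. K * h < \<delta>" using \<delta> by (intro order_tendstoD) auto
  then show ?thesis
    using eventually_at_right_less[of 0] by eventually_elim auto
qed

lemma point_value_bigo:
  "(\<lambda>h. u (xj + c * h) - (p0 + p1 * (c * h) + p2 * (c * h)\<^sup>2)) \<in> O[at_right 0](\<lambda>h. h ^ 3)"
proof (rule bigoI)
  show "\<forall>\<^sub>F h in at_right 0. norm (u (xj + c * h) - (p0 + p1 * (c * h) + p2 * (c * h)\<^sup>2)) \<le>
      (M * \<bar>c\<bar> ^ 3) * norm (h ^ 3)"
    using eventually_scaled_le[of "\<bar>c\<bar>"]
  proof eventually_elim
    case (elim h)
    then have "\<bar>c * h\<bar> = \<bar>c\<bar> * h" by (simp add: abs_mult)
    then show ?case using quad[of "c * h"] elim by (simp add: power_mult_distrib mult.assoc)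
  qed
qed

text \<open>End points are given in units of \<open>h\<close>, so one statement covers all three
  cells.\<close>

lemma cell_avg_bigo:
  assumes "a < b"
  shows "(\<lambda>h. cell_avg u {xj + a * h..xj + b * h} -
      (p0 + p1 * (a + b) / 2 * h + p2 * (a\<^sup>2 + a * b + b\<^sup>2) / 3 * h\<^sup>2)) \<in> O[at_right 0](\<lambda>h. h ^ 3)"
proof (rule bigoI)
  \<comment> \<open>The points of the cell lie within \<open>K * h\<close> of \<open>xj\<close>,
    which makes the cubic remainder uniform on the cell.\<close>
  define K where "K = max \<bar>a\<bar> \<bar>b\<bar>"
  show "\<forall>\<^sub>F h in at_right 0. norm (cell_avg u {xj + a * h..xj + b * h} -
      (p0 + p1 * (a + b) / 2 * h + p2 * (a\<^sup>2 + a * b + b\<^sup>2) / 3 * h\<^sup>2)) \<le> (\<bar>M\<bar> * K ^ 3) * norm (h ^ 3)"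
    using eventually_scaled_le[of K]
  proof eventually_elim
    case (elim h)
    have bd: "\<bar>t\<bar> \<le> K * h" if "a * h \<le> t" "t \<le> b * h" for t
    proof -
      have "b * h \<le> K * h" "- a * h \<le> K * h"
        using elim by (intro mult_right_mono; simp add: K_def)+
      with that show ?thesis by linarith
    qed
    have "\<bar>cell_avg u {xj + a * h..xj + b * h} -
        (p0 + p1 * (a * h + b * h) / 2 + p2 * ((a * h)\<^sup>2 + a * h * (b * h) + (b * h)\<^sup>2) / 3)\<bar>
        \<le> \<bar>M\<bar> * (K * h) ^ 3"
    proof (rule cell_avg_near_quadratic)
      show lt: "a * h < b * h" using assms elim by simp
      show "continuous_on {xj + a * h..xj + b * h} u"
        using bd[of "a * h"] bd[of "b * h"] lt elim
        by (intro continuous_on_subset[OF cont]) auto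
      show "\<bar>u (xj + t) - (p0 + p1 * t + p2 * t\<^sup>2)\<bar> \<le> \<bar>M\<bar> * (K * h) ^ 3"
        if "a * h \<le> t" "t \<le> b * h" for t
      proof -
        have "\<bar>u (xj + t) - (p0 + p1 * t + p2 * t\<^sup>2)\<bar> \<le> M * \<bar>t\<bar> ^ 3"
          using quad bd[OF that] elim by simp
        also have "\<dots> \<le> \<bar>M\<bar> * (K * h) ^ 3"
          using bd[OF that] by (intro mult_mono power_mono) auto
        finally show ?thesis .
      qed
    qed
    then show ?case
      using elim by (simp add: algebra_simps power_mult_distrib power2_eq_square add_divide_distrib)
  qed
qed

lemma cell_mid_avg_bigo:
  "(\<lambda>h. cell_avg u (cell_mid xj h) - (p0 + p2 / 12 * h\<^sup>2)) \<in> O[at_right 0](\<lambda>h. h ^ 3)"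
  using cell_avg_bigo[of "- 1 / 2" "1 / 2"] by (simp add: cell_mid_def power2_eq_square)

text \<open>The averages are known up to \<open>h ^ 3\<close>, and the slope divides their
  difference by a multiple of \<open>h\<close>. The second moments of the two cells differ by
  \<open>(1 + \<beta>) * (1 + 2 * \<beta>) / 6\<close>, whence the coefficient of
  \<open>h\<close>.\<close>

lemma slope_left_bigo:
  assumes "\<beta> > 0"
  shows "(\<lambda>h. slope u xj \<beta> \<gamma> h SideL - (p1 - p2 * (1 + 2 * \<beta>) / 3 * h)) \<in> O[at_right 0](\<lambda>h. h\<^sup>2)"
proof -
  let ?a = "- 1 / 2 - \<beta>" and ?b = "- 1 / 2 :: real"
  let ?E = "\<lambda>h. (cell_avg u (cell_mid xj h) - (p0 + p2 / 12 * h\<^sup>2)) -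
    (cell_avg u {xj + ?a * h..xj + ?b * h} -
      (p0 + p1 * (?a + ?b) / 2 * h + p2 * (?a\<^sup>2 + ?a * ?b + ?b\<^sup>2) / 3 * h\<^sup>2))"
  have "?E \<in> O[at_right 0](\<lambda>h. h ^ 3)"
    using assms by (intro sum_in_bigo cell_mid_avg_bigo cell_avg_bigo) auto
  then have "(\<lambda>h. 2 / (1 + \<beta>) * (?E h * inverse h)) \<in> O[at_right 0](\<lambda>h. h ^ 3 * inverse h)"
    by (intro landau_o.big.cmult_in_iff[THEN iffD2] landau_o.big.mult) (use assms in auto)
  \<comment> \<open>An equality of functions, valid also at 0 because
    \<open>inverse 0 = 0\<close>.\<close>
  also have "(\<lambda>h::real. h ^ 3 * inverse h) = (\<lambda>h. h\<^sup>2)"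
    by (simp add: fun_eq_iff power2_eq_square power3_eq_cube field_simps)
  also have "(\<lambda>h. 2 / (1 + \<beta>) * (?E h * inverse h)) \<in> O[at_right 0](\<lambda>h. h\<^sup>2) \<longleftrightarrow> ?thesis"
  proof (rule landau_o.big.in_cong)
    show "\<forall>\<^sub>F h in at_right 0. 2 / (1 + \<beta>) * (?E h * inverse h) =
        slope u xj \<beta> \<gamma> h SideL - (p1 - p2 * (1 + 2 * \<beta>) / 3 * h)"
      using eventually_at_right_less[of 0]
    proof eventually_elim
      case (elim h)
      have cl: "{xj + ?a * h..xj + ?b * h} = cell_left xj \<beta> h"
        by (simp add: cell_left_def algebra_simps)
      have "?E h = (cell_avg u (cell_mid xj h) - cell_avg u (cell_left xj \<beta> h)) -
          (1 + \<beta>) * h / 2 * (p1 - p2 * (1 + 2 * \<beta>) / 3 * h)"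
        unfolding cl by (simp add: algebra_simps power2_eq_square add_divide_distrib diff_divide_distrib)
      then show ?case
        unfolding slope.simps using assms elim by (intro scaled_difference_eq) (simp_all add: cl)
    qed
  qed
  finally show ?thesis .
qed

text \<open>Mirror image of \<open>slope_left_bigo\<close>; the reflection flips the sign of the
  correction.\<close>

lemma slope_right_bigo:
  assumes "\<gamma> > 0"
  shows "(\<lambda>h. slope u xj \<beta> \<gamma> h SideR - (p1 + p2 * (1 + 2 * \<gamma>) / 3 * h)) \<in> O[at_right 0](\<lambda>h. h\<^sup>2)"
proof -
  let ?a = "1 / 2 :: real" and ?b = "1 / 2 + \<gamma>"
  let ?E = "\<lambda>h. (cell_avg u {xj + ?a * h..xj + ?b * h} -
      (p0 + p1 * (?a + ?b) / 2 * h + p2 * (?a\<^sup>2 + ?a * ?b + ?b\<^sup>2) / 3 * h\<^sup>2)) -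
    (cell_avg u (cell_mid xj h) - (p0 + p2 / 12 * h\<^sup>2))"
  have "?E \<in> O[at_right 0](\<lambda>h. h ^ 3)"
    using assms by (intro sum_in_bigo cell_mid_avg_bigo cell_avg_bigo) auto
  then have "(\<lambda>h. 2 / (1 + \<gamma>) * (?E h * inverse h)) \<in> O[at_right 0](\<lambda>h. h ^ 3 * inverse h)"
    by (intro landau_o.big.cmult_in_iff[THEN iffD2] landau_o.big.mult) (use assms in auto)
  also have "(\<lambda>h::real. h ^ 3 * inverse h) = (\<lambda>h. h\<^sup>2)"
    by (simp add: fun_eq_iff power2_eq_square power3_eq_cube field_simps)
  also have "(\<lambda>h. 2 / (1 + \<gamma>) * (?E h * inverse h)) \<in> O[at_right 0](\<lambda>h. h\<^sup>2) \<longleftrightarrow> ?thesis"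
  proof (rule landau_o.big.in_cong)
    show "\<forall>\<^sub>F h in at_right 0. 2 / (1 + \<gamma>) * (?E h * inverse h) =
        slope u xj \<beta> \<gamma> h SideR - (p1 + p2 * (1 + 2 * \<gamma>) / 3 * h)"
      using eventually_at_right_less[of 0]
    proof eventually_elim
      case (elim h)
      have cr: "{xj + ?a * h..xj + ?b * h} = cell_right xj \<gamma> h"
        by (simp add: cell_right_def algebra_simps)
      have "?E h = (cell_avg u (cell_right xj \<gamma> h) - cell_avg u (cell_mid xj h)) -
          (1 + \<gamma>) * h / 2 * (p1 + p2 * (1 + 2 * \<gamma>) / 3 * h)"
        unfolding cr by (simp add: algebra_simps power2_eq_square add_divide_distrib diff_divide_distrib)
      then show ?case
        unfolding slope.simps using assms elim by (intro scaled_difference_eq) (simp_all add: cr)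
    qed
  qed
  finally show ?thesis .
qed

text \<open>Both slopes have the same leading term \<open>p1\<close>, which cancels.\<close>

lemma slope_diff_bigo:
  assumes "\<beta> > 0" "\<gamma> > 0"
  shows "(\<lambda>h. slope u xj \<beta> \<gamma> h SideL - slope u xj \<beta> \<gamma> h SideR) \<in> O[at_right 0](\<lambda>h. h)"
proof -
  have sq: "(\<lambda>h::real. h\<^sup>2) \<in> O[at_right 0](\<lambda>h. h)" using power_bigo_at_right_0[of 1 2] by simp
  let ?k = "p2 * (1 + 2 * \<beta>) / 3 + p2 * (1 + 2 * \<gamma>) / 3"
  have "(\<lambda>h. (slope u xj \<beta> \<gamma> h SideL - (p1 - p2 * (1 + 2 * \<beta>) / 3 * h)) -
      (slope u xj \<beta> \<gamma> h SideR - (p1 + p2 * (1 + 2 * \<gamma>) / 3 * h)) - ?k * h) \<in> O[at_right 0](\<lambda>h. h)"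
    by (intro sum_in_bigo(2) landau_o.big_trans[OF slope_left_bigo sq]
        landau_o.big_trans[OF slope_right_bigo sq] assms) simp
  also have "(\<lambda>h. (slope u xj \<beta> \<gamma> h SideL - (p1 - p2 * (1 + 2 * \<beta>) / 3 * h)) -
      (slope u xj \<beta> \<gamma> h SideR - (p1 + p2 * (1 + 2 * \<gamma>) / 3 * h)) - ?k * h) =
      (\<lambda>h. slope u xj \<beta> \<gamma> h SideL - slope u xj \<beta> \<gamma> h SideR)"
    by (simp add: fun_eq_iff ring_distribs del: slope.simps)
  finally show ?thesis .
qed

lemma slope_bounded:
  assumes "\<beta> > 0" "\<gamma> > 0"
  shows "(\<lambda>h. slope u xj \<beta> \<gamma> h s) \<in> O[at_right 0](\<lambda>_. 1)"
proof -
  have sq: "(\<lambda>h::real. h\<^sup>2) \<in> O[at_right 0](\<lambda>_. 1)" and lin: "(\<lambda>h::real. h) \<in> O[at_right 0](\<lambda>_. 1)"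
    using power_bigo_at_right_0[of 0 2] power_bigo_at_right_0[of 0 1] by simp_all
  have aff: "(\<lambda>h::real. p1 + k * h) \<in> O[at_right 0](\<lambda>_. 1)" for k
    using lin by (intro sum_in_bigo(1)) auto
  show ?thesis
  proof (cases s)
    case SideL
    have "(\<lambda>h. (slope u xj \<beta> \<gamma> h SideL - (p1 - p2 * (1 + 2 * \<beta>) / 3 * h)) +
        (p1 + (- p2 * (1 + 2 * \<beta>) / 3) * h)) \<in> O[at_right 0](\<lambda>_. 1)"
      by (intro sum_in_bigo(1) landau_o.big_trans[OF slope_left_bigo sq] aff assms)
    then show ?thesis unfolding SideL by (simp del: slope.simps)
  next
    case SideR
    have "(\<lambda>h. (slope u xj \<beta> \<gamma> h SideR - (p1 + p2 * (1 + 2 * \<gamma>) / 3 * h)) +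
        (p1 + (p2 * (1 + 2 * \<gamma>) / 3) * h)) \<in> O[at_right 0](\<lambda>_. 1)"
      by (intro sum_in_bigo(1) landau_o.big_trans[OF slope_right_bigo sq] aff assms)
    then show ?thesis unfolding SideR by (simp del: slope.simps)
  qed
qed

section \<open>Deviation of the nonlinear weights\<close>

text \<open>The indicators differ by \<open>h\<^sup>2\<close> times a difference of squared slopes,
  whose factors are O(h) and O(1). The lower bound on \<open>\<epsilon>\<close> absorbs the
  \<open>h\<^sup>2\<close> and covers both choices of \<open>\<epsilon>\<close>.\<close>

lemma indicator_ratio_bigo:
  assumes "\<beta> > 0" "\<gamma> > 0" "e > 0" "\<forall>\<^sub>F h in at_right 0. e * h\<^sup>2 \<le> \<epsilon> h"
  shows "(\<lambda>h. (\<epsilon> h + smooth_ind u xj \<beta> \<gamma> h SideL) / (\<epsilon> h + smooth_ind u xj \<beta> \<gamma> h SideR) - 1)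
    \<in> O[at_right 0](\<lambda>h. h)"
proof -
  let ?L = "\<lambda>h. slope u xj \<beta> \<gamma> h SideL" and ?R = "\<lambda>h. slope u xj \<beta> \<gamma> h SideR"
  have "(\<lambda>h. (\<epsilon> h + smooth_ind u xj \<beta> \<gamma> h SideL) / (\<epsilon> h + smooth_ind u xj \<beta> \<gamma> h SideR) - 1)
      \<in> O[at_right 0](\<lambda>h. (?L h - ?R h) * (?L h + ?R h))"
  proof (rule bigoI)
    show "\<forall>\<^sub>F h in at_right 0.
        norm ((\<epsilon> h + smooth_ind u xj \<beta> \<gamma> h SideL) / (\<epsilon> h + smooth_ind u xj \<beta> \<gamma> h SideR) - 1)
        \<le> inverse e * norm ((?L h - ?R h) * (?L h + ?R h))"
      using assms(4) eventually_at_right_less[of 0]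
    proof eventually_elim
      case (elim h)
      define l r where "l = ?L h" and "r = ?R h"
      have I: "smooth_ind u xj \<beta> \<gamma> h SideL = h\<^sup>2 * l\<^sup>2" "smooth_ind u xj \<beta> \<gamma> h SideR = h\<^sup>2 * r\<^sup>2"
        using elim by (simp_all only: smooth_ind_eq less_imp_le l_def r_def)
      have pos: "e * h\<^sup>2 > 0" using elim assms by simp
      have le: "e * h\<^sup>2 \<le> \<epsilon> h + h\<^sup>2 * r\<^sup>2" using elim by (simp add: add_increasing2)
      have "(\<epsilon> h + h\<^sup>2 * l\<^sup>2) / (\<epsilon> h + h\<^sup>2 * r\<^sup>2) - 1 = h\<^sup>2 * ((l - r) * (l + r)) / (\<epsilon> h + h\<^sup>2 * r\<^sup>2)"
        using pos le by (simp add: divide_simps) (simp add: algebra_simps power2_eq_square)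
      also have "\<bar>\<dots>\<bar> = h\<^sup>2 * \<bar>(l - r) * (l + r)\<bar> / (\<epsilon> h + h\<^sup>2 * r\<^sup>2)"
        using pos le by (simp add: abs_mult)
      \<comment> \<open>Only the lower bound \<open>e * h\<^sup>2\<close> of the denominator enters,
        so the case of vanishing slopes is included.\<close>
      also have "\<dots> \<le> h\<^sup>2 * \<bar>(l - r) * (l + r)\<bar> / (e * h\<^sup>2)"
        using pos le by (intro divide_left_mono) auto
      also have "\<dots> = inverse e * \<bar>(l - r) * (l + r)\<bar>"
        using elim by (simp add: divide_simps)
      finally show ?case unfolding I l_def[symmetric] r_def[symmetric] by simp
    qed
  qed
  also have "(\<lambda>h. (?L h - ?R h) * (?L h + ?R h)) \<in> O[at_right 0](\<lambda>h. h * 1)"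
    using assms by (intro landau_o.big.mult slope_diff_bigo sum_in_bigo(1) slope_bounded)
  finally show ?thesis by simp
qed

text \<open>By \<open>normalized_weight_diff\<close> the deviation is at most that of the
  \<open>\<tau>\<close>-th power of the indicator ratio from 1.\<close>

lemma weight_diff_bigo:
  assumes "\<beta> > 0" "\<gamma> > 0" "e > 0" "\<forall>\<^sub>F h in at_right 0. e * h\<^sup>2 \<le> \<epsilon> h"
  shows "(\<lambda>h. weight u xj \<beta> \<gamma> \<tau> (\<epsilon> h) h b SideL - lin_weight \<beta> \<gamma> b SideL) \<in> O[at_right 0](\<lambda>h. h)"
proof -
  let ?D = "\<lambda>h s. \<epsilon> h + smooth_ind u xj \<beta> \<gamma> h s"
  have "(\<lambda>h. weight u xj \<beta> \<gamma> \<tau> (\<epsilon> h) h b SideL - lin_weight \<beta> \<gamma> b SideL)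
      \<in> O[at_right 0](\<lambda>h. (?D h SideL / ?D h SideR) powr \<tau> - 1)"
  proof (rule bigoI[where c = 1])
    show "\<forall>\<^sub>F h in at_right 0. norm (weight u xj \<beta> \<gamma> \<tau> (\<epsilon> h) h b SideL - lin_weight \<beta> \<gamma> b SideL)
        \<le> 1 * norm ((?D h SideL / ?D h SideR) powr \<tau> - 1)"
      using assms(4) eventually_at_right_less[of 0]
    proof eventually_elim
      case (elim h)
      have pos: "?D h s > 0" for s
      proof -
        have "0 < e * h\<^sup>2" using elim assms by simp
        also have "\<dots> \<le> ?D h s" using elim by (simp add: smooth_ind_eq add_increasing2)
        finally show ?thesis .
      qed
      then show ?case
        using normalized_weight_diff[of "?D h SideL powr \<tau>" "?D h SideR powr \<tau>"
            "lin_weight \<beta> \<gamma> b SideL" "lin_weight \<beta> \<gamma> b SideR"]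
          lin_weight_pos[OF assms(1,2)] lin_weight_sum[OF assms(1,2), of b]
          pos[of SideL] pos[of SideR]
        by (simp add: weight_def weight_tilde_def powr_divide less_imp_le)
    qed
  qed
  also have "(\<lambda>h. (?D h SideL / ?D h SideR) powr \<tau> - 1) \<in> O[at_right 0](\<lambda>h. h)"
    by (intro powr_minus_one_bigo indicator_ratio_bigo[OF assms]) (rule tendsto_ident_at)
  finally show ?thesis .
qed

text \<open>Eliminates the right weight, so that only the left deviation has to be
  estimated.\<close>

lemma weight_sum:
  assumes "\<beta> > 0" "\<gamma> > 0" "e > 0" "h > 0"
  shows "weight u xj \<beta> \<gamma> \<tau> e h b SideL + weight u xj \<beta> \<gamma> \<tau> e h b SideR = 1"
proof -
  have "weight_tilde u xj \<beta> \<gamma> \<tau> e h b s > 0" for s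
  proof -
    have "e + smooth_ind u xj \<beta> \<gamma> h s > 0"
      using assms by (simp add: smooth_ind_eq add_pos_nonneg)
    then show ?thesis using lin_weight_pos[OF assms(1,2)] by (simp add: weight_tilde_def)
  qed
  from this[of SideL] this[of SideR] show ?thesis
    by (simp add: weight_def add_divide_distrib[symmetric])
qed

section \<open>Third-order accuracy\<close>

lemma weno3_bigo:
  assumes "\<beta> > 0" "\<gamma> > 0" "e > 0" "\<forall>\<^sub>F h in at_right 0. e * h\<^sup>2 \<le> \<epsilon> h"
  shows "(\<lambda>h. u (bdry_point xj h b) - weno3 u xj \<beta> \<gamma> \<tau> (\<epsilon> h) h b) \<in> O[at_right 0](\<lambda>h. h ^ 3)"
proof -
  let ?t = "bdry_offset b" and ?C = "lin_weight \<beta> \<gamma> b"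
  let ?S = "\<lambda>h. slope u xj \<beta> \<gamma> h" and ?w = "\<lambda>h. weight u xj \<beta> \<gamma> \<tau> (\<epsilon> h) h b"
  let ?EP = "\<lambda>h. u (xj + ?t * h) - (p0 + p1 * (?t * h) + p2 * (?t * h)\<^sup>2)"
  let ?EM = "\<lambda>h. cell_avg u (cell_mid xj h) - (p0 + p2 / 12 * h\<^sup>2)"
  let ?EL = "\<lambda>h. ?S h SideL - (p1 - p2 * (1 + 2 * \<beta>) / 3 * h)"
  let ?ER = "\<lambda>h. ?S h SideR - (p1 + p2 * (1 + 2 * \<gamma>) / 3 * h)"
  \<comment> \<open>The reconstruction error split into four parts: point value, cell average,
    slopes under linear weights, and weight deviation times slope difference. The polynomial terms
    cancel.\<close>
  let ?E = "\<lambda>h. ?EP h - ?EM h - ?t * (h * (?C SideL * ?EL h + ?C SideR * ?ER h)) -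
    ?t * (h * ((?w h SideL - ?C SideL) * (?S h SideL - ?S h SideR)))"
  have lin: "(\<lambda>h. h * (?C SideL * ?EL h + ?C SideR * ?ER h)) \<in> O[at_right 0](\<lambda>h. h * h\<^sup>2)"
    using slope_left_bigo[OF assms(1), of \<gamma>] slope_right_bigo[OF assms(2), of \<beta>]
    by (intro landau_o.big.mult sum_in_bigo(1) landau_o.big.cmult_in_iff'[THEN iffD2]) auto
  have nonlin: "(\<lambda>h. h * ((?w h SideL - ?C SideL) * (?S h SideL - ?S h SideR)))
      \<in> O[at_right 0](\<lambda>h. h * (h * h))"
    using assms by (intro landau_o.big.mult weight_diff_bigo[OF assms] slope_diff_bigo) auto
  have cube: "h * h\<^sup>2 = h ^ 3" "h * (h * h) = h ^ 3" for h :: real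
    by (simp_all add: power2_eq_square power3_eq_cube)
  have "?E \<in> O[at_right 0](\<lambda>h. h ^ 3)"
    using lin nonlin unfolding cube
    by (intro sum_in_bigo(2) point_value_bigo cell_mid_avg_bigo) (auto simp del: slope.simps)
  also have "?E \<in> O[at_right 0](\<lambda>h. h ^ 3) \<longleftrightarrow> ?thesis"
  proof (rule landau_o.big.in_cong)
    show "\<forall>\<^sub>F h in at_right 0. ?E h = u (bdry_point xj h b) - weno3 u xj \<beta> \<gamma> \<tau> (\<epsilon> h) h b"
      using assms(4) eventually_at_right_less[of 0]
    proof eventually_elim
      case (elim h)
      have "0 < e * h\<^sup>2" using elim assms by simp
      then have "\<epsilon> h > 0" using elim by linarith
      then have wR: "?w h SideR = 1 - ?w h SideL" using weight_sum assms elim by smt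
      have CR: "?C SideR = 1 - ?C SideL" using lin_weight_sum[OF assms(1,2), of b] by linarith
      have mom: "(1 - ?C SideL) * (1 + 2 * \<gamma>) - ?C SideL * (1 + 2 * \<beta>) = 2 * ?t"
        using lin_weight_moment[OF assms(1,2), of b] unfolding CR .
      have tt: "?t * ?t = 1 / 4" using bdry_offset_sq[of b] by (simp add: power2_eq_square)
      define w c sL sR t m where defs: "w = ?w h SideL" "c = ?C SideL" "sL = ?S h SideL"
        "sR = ?S h SideR" "t = ?t" "m = cell_avg u (cell_mid xj h)"
      have weno: "weno3 u xj \<beta> \<gamma> \<tau> (\<epsilon> h) h b = m + t * h * (w * sL + (1 - w) * sR)"
        unfolding weno3_def wR cand_poly_def bdry_point_eq defs[symmetric]
        by (simp add: algebra_simps)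
      have "c * (p1 - p2 * (1 + 2 * \<beta>) / 3 * h) + (1 - c) * (p1 + p2 * (1 + 2 * \<gamma>) / 3 * h) =
          p1 + p2 / 3 * h * ((1 - c) * (1 + 2 * \<gamma>) - c * (1 + 2 * \<beta>))"
        by (simp add: field_simps)
      \<comment> \<open>The moment identity of the linear weights enters here.\<close>
      also have "\<dots> = p1 + p2 / 3 * h * (2 * t)" using mom by (simp add: defs)
      finally have comb: "c * (p1 - p2 * (1 + 2 * \<beta>) / 3 * h) + (1 - c) * (p1 + p2 * (1 + 2 * \<gamma>) / 3 * h) =
        p1 + p2 / 3 * h * (2 * t)" .
      define TL TR where "TL = p1 - p2 * (1 + 2 * \<beta>) / 3 * h" "TR = p1 + p2 * (1 + 2 * \<gamma>) / 3 * h"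
      have "c * (sL - TL) + (1 - c) * (sR - TR) = c * sL + (1 - c) * sR - (p1 + p2 / 3 * h * (2 * t))"
        using comb unfolding TL_TR_def by (simp add: right_diff_distrib)
      \<comment> \<open>Since \<open>t * t = 1 / 4\<close>, the quadratic term is
        \<open>p2 * h\<^sup>2 / 6\<close>; it cancels because 1/4 (point value) minus 1/12 (cell
        average) is 1/6.\<close>
      moreover have "t * (h * (p1 + p2 / 3 * h * (2 * t))) = t * h * p1 + p2 * h\<^sup>2 / 6"
      proof -
        have "t * (h * (p1 + p2 / 3 * h * (2 * t))) = t * h * p1 + 2 / 3 * p2 * h\<^sup>2 * (t * t)"
          by (simp add: algebra_simps power2_eq_square)
        then show ?thesis using tt by (simp add: defs)
      qed
      \<comment> \<open>Stated for all \<open>y\<close> and \<open>z\<close> to serve as a rewrite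
        rule in the next step.\<close>
      moreover have "t * (h * (y - z)) = t * h * y - t * (h * z)" for y z
        by (simp add: algebra_simps)
      ultimately have lin_part: "t * (h * (c * (sL - TL) + (1 - c) * (sR - TR))) =
          t * h * (c * sL + (1 - c) * sR) - (t * h * p1 + p2 * h\<^sup>2 / 6)"
        by (simp only:)
      have sq: "(t * h)\<^sup>2 = h\<^sup>2 / 4"
        using tt by (simp add: defs power_mult_distrib power2_eq_square)
      show ?case
        unfolding weno CR bdry_point_eq defs[symmetric] TL_TR_def[symmetric] lin_part sq
        by (simp add: algebra_simps)
    qed
  qed
  finally show ?thesis .
qed

end

theorem theorem5:
  fixes u :: "real \<Rightarrow> real" and xj \<beta> \<gamma> \<epsilon>hat \<tau> h0 :: real and \<epsilon> :: "real \<Rightarrow> real"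
  assumes "\<beta> > 0" and "\<gamma> > 0" and "\<epsilon>hat > 0"
    and "h0 > 0" and "smooth_on (stencil xj \<beta> \<gamma> h0) u"
    and "\<epsilon> = (\<lambda>h. \<epsilon>hat * h) \<or> \<epsilon> = (\<lambda>h. \<epsilon>hat * h\<^sup>2)"
  shows "(\<lambda>h. u (xj + h / 2) - weno3 u xj \<beta> \<gamma> \<tau> (\<epsilon> h) h Plus) \<in> O[at_right 0](\<lambda>h. h ^ 3) \<and>
         (\<lambda>h. u (xj - h / 2) - weno3 u xj \<beta> \<gamma> \<tau> (\<epsilon> h) h Minus) \<in> O[at_right 0](\<lambda>h. h ^ 3)"
proof -
  have pos: "\<beta> * h0 > 0" "\<gamma> * h0 > 0" using assms by simp_all
  then have "stencil xj \<beta> \<gamma> h0 = {xj - h0 / 2 - \<beta> * h0..xj + h0 / 2 + \<gamma> * h0}"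
    using assms(4) by (auto simp: stencil_def cell_left_def cell_mid_def cell_right_def)
  with assms(5) have "smooth_on {xj - h0 / 2 - \<beta> * h0..xj + h0 / 2 + \<gamma> * h0} u" by simp
  then obtain \<delta> p0 p1 p2 M where T: "\<delta> > 0" "continuous_on {xj - \<delta>..xj + \<delta>} u"
    "\<And>t. \<bar>t\<bar> \<le> \<delta> \<Longrightarrow> \<bar>u (xj + t) - (p0 + p1 * t + p2 * t\<^sup>2)\<bar> \<le> M * \<bar>t\<bar> ^ 3"
    by (rule taylor_quadratic_remainder[where x = xj]) (use assms(4) pos in linarith, use assms(4) pos in linarith, use that in blast)
  have "\<forall>\<^sub>F h in at_right (0::real). 0 < h \<and> h < 1"
    unfolding eventually_at_right_field by (intro exI[of _ 1]) auto
  \<comment> \<open>For \<open>h < 1\<close> also \<open>h\<^sup>2 \<le> h\<close>, so both choices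
    of \<open>\<epsilon>\<close> satisfy the lower bound with constant
    \<open>\<epsilon>hat\<close>.\<close>
  then have "\<forall>\<^sub>F h in at_right 0. \<epsilon>hat * h\<^sup>2 \<le> \<epsilon> h"
    by eventually_elim (use assms(3,6) in \<open>auto simp: power2_eq_square mult_left_le\<close>)
  note third_order = weno3_bigo[OF T assms(1-3) this, where \<tau> = \<tau>]
  from third_order[where b = Plus] third_order[where b = Minus] show ?thesis
    by (simp only: bdry_point.simps simp_thms)
qed

end
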